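(* For every integer $k\geq 1$, the integers $12^k$ and $18^k$ are $5$-Zaremba.
   Context: For integers $a_1,\dots,a_n\geq 1$, $[0,a_1,a_2,\dots,a_n]$ denotes the simple continued fraction $$\cfrac{1}{a_1+\cfrac{1}{a_2+\cfrac{1}{\ddots+\cfrac{1}{a_n}}}},$$ and the $a_j$ are its partial quotients. The finite continued fraction expansion of a rational number is made unique by requiring $a_n>1$. For a positive integer $A$, an integer $D\geq 2$ is called $A$-Zaremba if there is a reduced fraction $\frac{b}{D}=[0,a_1,a_2,\dots,a_n]$ (that is, $\gcd(b,D)=1$) with $\max_j a_j\leq A$. *)

theory Defs
  imports Complex_Main
begin

text \<open>The list \<open>[a1, ..., an]\<close> stands for the continued fraction \<open>[0, a1, ..., an]\<close>;
  the leading partial quotient \<open>0\<close> is left implicit.\<close>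

fun cfrac_value :: "nat list \<Rightarrow> rat" where
  "cfrac_value [] = 0"
| "cfrac_value (a # as) = 1 / (of_nat a + cfrac_value as)"

text \<open>The condition on the last partial quotient excludes the alternative ending
  \<open>an - 1, 1\<close> and so makes the expansion unique.\<close>

definition is_cfrac_expansion :: "nat list \<Rightarrow> rat \<Rightarrow> bool" where
  "is_cfrac_expansion as x \<longleftrightarrow>
     as \<noteq> [] \<and> (\<forall>a\<in>set as. a \<ge> 1) \<and> last as > 1 \<and> x = cfrac_value as"

text \<open>No upper bound on \<open>b\<close> is needed: the value of an expansion lies strictly between
  \<open>0\<close> and \<open>1\<close>.\<close>

definition zaremba :: "nat \<Rightarrow> nat \<Rightarrow> bool" where
  "zaremba A D \<longleftrightarrow> D \<ge> 2 \<and>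
     (\<exists>b as. coprime b D \<and> is_cfrac_expansion as (of_nat b / of_nat D) \<and> Max (set as) \<le> A)"

end

theory Submission
  imports Defs
begin

text \<open>
  The proof rests on the folding lemma for continued fractions. Step by step, a continued fraction
  \<open>[0, a1, ..., an]\<close> is evaluated by the symmetric matrices with rows \<open>(a, 1)\<close> and \<open>(1, 0)\<close>, so
  reversing a list of partial quotients transposes its matrix. Hence the denominator of a list that
  is a palindrome up to a short middle block is a quadratic form, determined by the middle block, in
  the denominators of its half with and without the innermost quotient. For the block
  \<open>an, x - 1, 1, an - 1\<close>, and for its degenerate form \<open>an + 1, an - 1\<close> when \<open>x = 1\<close>, this form is
  \<open>x\<close> times a perfect square: from denominator \<open>D\<close> one obtains denominator \<open>x * D\<^sup>2\<close>.

  Folding keeps all partial quotients in \<open>{1..5}\<close> for every \<open>x \<le> 6\<close>, provided that the last one lies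
  between \<open>2\<close> and \<open>4\<close>; and the folded list both begins and ends with the old first partial quotient.
  So the set of denominators that have an expansion with at least two quotients, all in
  \<open>{1..5}\<close> and the first and last in \<open>{2..4}\<close>, is closed under \<open>D \<mapsto> x * D\<^sup>2\<close> for all \<open>x \<in> {1..6}\<close> (\<open>foldable_mult_square\<close>).

  Squaring alone does not reach the odd powers of \<open>12 = 3 * 2\<^sup>2\<close>, since \<open>x = 12\<close> is too large. They
  become reachable when the numbers \<open>2 * 12 ^ k\<close> are carried along:
  \<open>12 ^ (2 * j + 1) = 3 * (2 * 12 ^ j)\<^sup>2\<close> and \<open>2 * 12 ^ (2 * j + 1) = 6 * (2 * 12 ^ j)\<^sup>2\<close>. The same
  works for \<open>18 = 2 * 3\<^sup>2\<close> with the companions \<open>3 * 18 ^ k\<close>, so that only the denominators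
  12, 24, 18 and 54 need explicit expansions.
\<close>

section \<open>Continued fractions as products of symmetric matrices\<close>

text \<open>The product of the matrices with rows \<open>(a, 1)\<close> and \<open>(1, 0)\<close>, applied to a vector. On
  \<open>(1, 0)\<close> it yields the denominator and the numerator of the continued fraction.\<close>

fun cfrac_act :: "nat list \<Rightarrow> nat \<times> nat \<Rightarrow> nat \<times> nat" where
  "cfrac_act [] v = v"
| "cfrac_act (a # as) v = (a * fst (cfrac_act as v) + snd (cfrac_act as v), fst (cfrac_act as v))"

definition cfrac_denom :: "nat list \<Rightarrow> nat" where
  "cfrac_denom as = fst (cfrac_act as (1, 0))"

definition dot :: "nat \<times> nat \<Rightarrow> nat \<times> nat \<Rightarrow> nat" where
  "dot v w = fst v * fst w + snd v * snd w"

lemma cfrac_act_append: "cfrac_act (as @ bs) v = cfrac_act as (cfrac_act bs v)"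
  by (induction as) auto

text \<open>Every factor of the product is symmetric, so transposition only reverses their order.\<close>

lemma dot_cfrac_act: "dot (cfrac_act as v) w = dot v (cfrac_act (rev as) w)"
proof (induction as arbitrary: w)
  case Nil
  then show ?case by simp
next
  case (Cons a as)
  have "dot (cfrac_act (a # as) v) w = dot (cfrac_act as v) (cfrac_act [a] w)"
    by (simp add: dot_def algebra_simps)
  also have "\<dots> = dot v (cfrac_act (rev (a # as)) w)"
    by (simp add: Cons.IH cfrac_act_append)
  finally show ?case .
qed

text \<open>This form serves to split a folded list behind its first half, so that the folded and the
  unfolded denominator are both expressed by the vector of \<open>rev as\<close>.\<close>

lemma cfrac_denom_append:
  "cfrac_denom (as @ bs) = dot (cfrac_act bs (1, 0)) (cfrac_act (rev as) (1, 0))"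
proof -
  have "cfrac_denom (as @ bs) = dot (cfrac_act as (cfrac_act bs (1, 0))) (1, 0)"
    by (simp add: cfrac_denom_def cfrac_act_append dot_def)
  then show ?thesis
    by (simp add: dot_cfrac_act)
qed

lemma cfrac_denom_pos: "\<forall>a\<in>set as. a \<ge> 1 \<Longrightarrow> cfrac_denom as > 0"
  by (induction as) (auto simp: cfrac_denom_def)

lemma coprime_cfrac_act: "coprime (fst (cfrac_act as (1, 0))) (snd (cfrac_act as (1, 0)))"
proof (induction as)
  case (Cons a as)
  then show ?case
    by (simp add: coprime_iff_gcd_eq_1 gcd_add_mult gcd.commute[of "_ + _"])
qed simp

lemma cfrac_value_eq:
  assumes "\<forall>a\<in>set as. a \<ge> 1"
  shows "cfrac_value as = of_nat (snd (cfrac_act as (1, 0))) / of_nat (cfrac_denom as)"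
  using assms
proof (induction as)
  case Nil
  then show ?case by simp
next
  case (Cons a as)
  then have "cfrac_denom as > 0"
    by (intro cfrac_denom_pos) auto
  then have "of_nat a + of_nat (snd (cfrac_act as (1, 0))) / of_nat (cfrac_denom as) =
      (of_nat (cfrac_denom (a # as)) / of_nat (cfrac_denom as) :: rat)"
    by (simp add: cfrac_denom_def field_simps)
  with Cons show ?case
    by (simp add: cfrac_denom_def)
qed

section \<open>Folding\<close>

text \<open>Let \<open>(p, q)\<close> be the vector of \<open>rev as\<close>. Then \<open>as @ [a + 1]\<close> has denominator
  \<open>N = (a + 1) * p + q\<close>, and the denominator of the folded list is the quadratic form of the middle
  block at \<open>(p, q)\<close>, which equals \<open>x * N\<^sup>2\<close> with \<open>x = y + 1\<close>. The shifts by one avoid the truncated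
  subtractions in the block \<open>an, x - 1, 1, an - 1\<close>.\<close>

lemma cfrac_denom_fold:
  "cfrac_denom (as @ [a + 1, y, 1, a] @ rev as) = (y + 1) * (cfrac_denom (as @ [a + 1]))\<^sup>2"
proof -
  obtain p q where pq: "cfrac_act (rev as) (1, 0) = (p, q)"
    by fastforce
  show ?thesis
    unfolding cfrac_denom_append cfrac_act_append pq
    by (simp add: dot_def algebra_simps power2_eq_square)
qed

text \<open>For \<open>x = 1\<close> the block would contain a zero. Since \<open>[..., c, 0, d, ...]\<close> and
  \<open>[..., c + d, ...]\<close> have the same value, it collapses.\<close>

lemma cfrac_denom_fold_one:
  "cfrac_denom (as @ [a + 2, a] @ rev as) = (cfrac_denom (as @ [a + 1]))\<^sup>2"
proof -
  obtain p q where pq: "cfrac_act (rev as) (1, 0) = (p, q)"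
    by fastforce
  show ?thesis
    unfolding cfrac_denom_append cfrac_act_append pq
    by (simp add: dot_def algebra_simps power2_eq_square)
qed

section \<open>Denominators closed under folding\<close>

text \<open>The bounds on the last quotient \<open>t\<close> keep \<open>t - 1\<close> and \<open>t + 1\<close> within \<open>{1..5}\<close>. The first quotient
  \<open>h\<close> is bounded in the same way because it becomes the last one after folding. Listing \<open>h\<close> and \<open>t\<close>
  separately forces at least two quotients: for a single one, the end of the folded list would be
  \<open>t - 1\<close> rather than \<open>h\<close>.\<close>

definition foldable :: "nat \<Rightarrow> bool" where
  "foldable D \<longleftrightarrow> (\<exists>h as t. h \<in> {2..4} \<and> t \<in> {2..4} \<and> set as \<subseteq> {1..5} \<and>
     D = cfrac_denom (h # as @ [t]))"

lemma foldable_imp_zaremba: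
  assumes "foldable D"
  shows "zaremba 5 D"
proof -
  from assms obtain h as t where h: "h \<in> {2..4}" and t: "t \<in> {2..4}"
    and as: "set as \<subseteq> {1..5}" and D: "D = cfrac_denom (h # as @ [t])"
    unfolding foldable_def by blast
  define bs where "bs = h # as @ [t]"
  define b where "b = snd (cfrac_act bs (1, 0))"
  have bs: "set bs \<subseteq> {1..5}"
    using h t as by (auto simp: bs_def)
  have "cfrac_denom (as @ [t]) > 0"
    using bs by (intro cfrac_denom_pos) (auto simp: bs_def)
  then have "h * 1 \<le> h * cfrac_denom (as @ [t])"
    by (intro mult_le_mono) auto
  also have "\<dots> \<le> D"
    by (simp add: D cfrac_denom_def)
  finally have "D \<ge> 2"
    using h by simp
  moreover have "coprime b D"
    using coprime_cfrac_act[of bs] by (simp add: b_def bs_def D cfrac_denom_def coprime_commute)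
  moreover have "is_cfrac_expansion bs (of_nat b / of_nat D)"
    unfolding is_cfrac_expansion_def
  proof (intro conjI)
    show "bs \<noteq> []" and "last bs > 1"
      using t by (simp_all add: bs_def)
    show *: "\<forall>a\<in>set bs. a \<ge> 1"
      using bs by auto
    show "of_nat b / of_nat D = cfrac_value bs"
      using cfrac_value_eq[OF *] by (simp add: b_def bs_def D)
  qed
  moreover have "Max (set bs) \<le> 5"
    using bs by (subst Max_le_iff) (auto simp: bs_def)
  ultimately show ?thesis
    unfolding zaremba_def by blast
qed

lemma foldable_mult_square:
  assumes "foldable D" and x: "x \<in> {1..6}"
  shows "foldable (x * D\<^sup>2)"
proof -
  from assms(1) obtain h as t where h: "h \<in> {2..4}" and t: "t \<in> {2..4}"
    and as: "set as \<subseteq> {1..5}" and D: "D = cfrac_denom (h # as @ [t])"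
    unfolding foldable_def by blast
  obtain a where a: "t = a + 1"
    using t by (cases t) auto
  obtain y where y: "x = y + 1"
    using x by (cases x) auto
  show ?thesis
  proof (cases "y = 0")
    case True
    have "x * D\<^sup>2 = cfrac_denom (h # (as @ [a + 2, a] @ rev as) @ [h])"
      using cfrac_denom_fold_one[of "h # as" a] by (simp add: D a y True)
    moreover have "set (as @ [a + 2, a] @ rev as) \<subseteq> {1..5}"
      using as t a by auto
    ultimately show ?thesis
      using h unfolding foldable_def by blast
  next
    case False
    have "x * D\<^sup>2 = cfrac_denom (h # (as @ [a + 1, y, 1, a] @ rev as) @ [h])"
      using cfrac_denom_fold[of "h # as" a y] by (simp add: D a y)
    moreover have "set (as @ [a + 1, y, 1, a] @ rev as) \<subseteq> {1..5}"
      using as t a x y False by auto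
    ultimately show ?thesis
      using h unfolding foldable_def by blast
  qed
qed

section \<open>Powers\<close>

text \<open>Put \<open>B = x * m\<^sup>2\<close>. Then \<open>B ^ (2 * j) = (B ^ j)\<^sup>2\<close> and
  \<open>B ^ (2 * j + 1) = x * (m * B ^ j)\<^sup>2\<close>, so a fold with a multiplier among \<open>1\<close>, \<open>m\<close>, \<open>x\<close>,
  \<open>m * x\<close> halves the exponent for both families at once.\<close>

lemma foldable_powers:
  assumes mx: "m \<ge> 1" "x \<ge> 1" "m * x \<le> 6"
    and base: "foldable (x * m\<^sup>2)" "foldable (m * (x * m\<^sup>2))"
    and "k \<ge> 1"
  shows "foldable ((x * m\<^sup>2) ^ k) \<and> foldable (m * (x * m\<^sup>2) ^ k)"
  using \<open>k \<ge> 1\<close>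
proof (induction k rule: less_induct)
  case (less k)
  define B where "B = x * m\<^sup>2"
  have "m \<le> m * x" "x \<le> m * x"
    using mx by simp_all
  then have "m \<le> 6" "x \<le> 6"
    using mx(3) by (blast intro: le_trans)+
  then have mults: "m \<in> {1..6}" "x \<in> {1..6}" "m * x \<in> {1..6}"
    using mx by auto
  consider "k = 1" | j where "k = 2 * j" "j \<ge> 1" | j where "k = 2 * j + 1" "j \<ge> 1"
    using less.prems by (cases "even k"; cases "k = 1") (auto elim!: evenE oddE)
  then show ?case
  proof cases
    case 1
    then show ?thesis using base by simp
  next
    case 2
    then have IH: "foldable (B ^ j)"
      using less.IH[of j] by (simp add: B_def)
    have "B ^ k = 1 * (B ^ j)\<^sup>2"
      by (simp add: 2 power_mult mult.commute)
    moreover have "m * B ^ k = m * (B ^ j)\<^sup>2"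
      by (simp add: 2 power_mult mult.commute)
    ultimately show ?thesis
      using foldable_mult_square[OF IH, of 1] foldable_mult_square[OF IH, of m] mults
      by (simp add: B_def)
  next
    case 3
    then have IH: "foldable (m * B ^ j)"
      using less.IH[of j] by (simp add: B_def)
    have "B ^ k = B * (B ^ j)\<^sup>2"
      by (simp add: 3 power_mult mult.commute)
    also have "\<dots> = x * (m * B ^ j)\<^sup>2"
      by (simp add: B_def power_mult_distrib mult_ac)
    finally have "B ^ k = x * (m * B ^ j)\<^sup>2" .
    then show ?thesis
      using foldable_mult_square[OF IH mults(2)] foldable_mult_square[OF IH mults(3)]
      by (simp add: B_def mult.assoc)
  qed
qed

text \<open>The expansions below are those of \<open>5/12\<close>, \<open>5/24\<close>, \<open>5/18\<close> and \<open>17/54\<close>.\<close>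

lemma foldable_12: "foldable 12"
  unfolding foldable_def
  by (rule exI[of _ 2], rule exI[of _ "[2]"], rule exI[of _ 2]) (simp add: cfrac_denom_def)

lemma foldable_24: "foldable 24"
  unfolding foldable_def
  by (rule exI[of _ 4], rule exI[of _ "[1]"], rule exI[of _ 4]) (simp add: cfrac_denom_def)

lemma foldable_18: "foldable 18"
  unfolding foldable_def
  by (rule exI[of _ 3], rule exI[of _ "[1, 1]"], rule exI[of _ 2]) (simp add: cfrac_denom_def)

lemma foldable_54: "foldable 54"
  unfolding foldable_def
  by (rule exI[of _ 3], rule exI[of _ "[5, 1]"], rule exI[of _ 2]) (simp add: cfrac_denom_def)

theorem corollary7:
  fixes k :: nat
  assumes "k \<ge> 1"
  shows "zaremba 5 (12 ^ k) \<and> zaremba 5 (18 ^ k)"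
proof -
  have "foldable (12 ^ k)"
    using foldable_powers[of 2 3 k] foldable_12 foldable_24 assms by simp
  moreover have "foldable (18 ^ k)"
    using foldable_powers[of 3 2 k] foldable_18 foldable_54 assms by simp
  ultimately show ?thesis
    by (simp add: foldable_imp_zaremba)
qed

end
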